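(* Let $f$ be a probability measure on $\mathbb{R}$, without an atom at $0$, such that $\int_{\mathbb{R}}x^2 f(dx)=1$. Then $(\hat f^N)_N$ is Kac chaotic to $f$. Moreover, if $\int_{\mathbb{R}}|x|^p f(dx)<\infty$ for some $p>2$, then there exists a constant $C$ depending only on $p$ and $\int_{\mathbb{R}}|x|^pf(dx)$ such that, for all $N\ge 2$, $$\frac1N W_2(\hat f^N,f^{\otimes N})^2\le C\begin{cases} N^{-1/2}, & p>4,\\ N^{-1/2}\log(N), & p=4,\\ N^{-(1-2/p)}, & p\in(2,4).\end{cases}$$
   Context: Kac chaos: a sequence $(F^N)_{N}$, where $F^N$ is a probability measure on $\mathbb{R}^N$ invariant under permutations of the coordinates, is Kac chaotic to a probability measure $f$ on $\mathbb{R}$ if for every $k\in\mathbb{N}$ the marginal of $F^N$ on its first $k$ coordinates converges weakly to $f^{\otimes k}$ as $N\to\infty$. Kac's sphere is $S^{N-1}=\{x\in\mathbb{R}^N:\sum_i x_i^2=N\}$. For $x\in\mathbb{R}^N\setminus\{0\}$ put $\hat x=\frac{\sqrt N}{|x|}x\in S^{N-1}$. For a probability measure $f$ on $\mathbb{R}$ without an atom at $0$, $\hat f^N$ is the push-forward of $f^{\otimes N}$ under $x\mapsto\hat x$ (a probability measure on $S^{N-1}\subset\mathbb{R}^N$). $W_2$ is the 2-Wasserstein distance on probability measures on $\mathbb{R}^N$ with finite second moment, with respect to the Euclidean norm (no normalization by $N$): $W_2(F,G)^2=\inf_\pi\int|x-y|^2\pi(dx,dy)$ over couplings $\pi$ of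 $F$ and $G$. *)

theory Defs
  imports "HOL-Probability.Probability"
begin

text \<open>
  A vector of $R^n$ is a function in \<open>{..<n} \<rightarrow>\<^sub>E UNIV\<close>, the space of the product measures below;
  the coordinates are numbered from \<open>0\<close> to \<open>n - 1\<close>.
\<close>

abbreviation borel_n :: "nat \<Rightarrow> (nat \<Rightarrow> real) measure"
  where "borel_n n \<equiv> PiM {..<n} (\<lambda>_. borel)"

abbreviation tensor_power :: "nat \<Rightarrow> real measure \<Rightarrow> (nat \<Rightarrow> real) measure"
  where "tensor_power n f \<equiv> PiM {..<n} (\<lambda>_. f)"

definition prob_measure_n :: "nat \<Rightarrow> (nat \<Rightarrow> real) measure \<Rightarrow> bool"
  where "prob_measure_n n F \<longleftrightarrow> prob_space F \<and> sets F = sets (borel_n n)"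

definition symmetric_measure :: "nat \<Rightarrow> (nat \<Rightarrow> real) measure \<Rightarrow> bool"
  where "symmetric_measure n F \<longleftrightarrow>
    (\<forall>\<sigma>. \<sigma> permutes {..<n} \<longrightarrow> distr F (borel_n n) (\<lambda>x. \<lambda>i\<in>{..<n}. x (\<sigma> i)) = F)"

definition marginal :: "nat \<Rightarrow> (nat \<Rightarrow> real) measure \<Rightarrow> (nat \<Rightarrow> real) measure"
  where "marginal k F = distr F (borel_n k) (\<lambda>x. restrict x {..<k})"

definition weakly_converges ::
    "nat \<Rightarrow> (nat \<Rightarrow> (nat \<Rightarrow> real) measure) \<Rightarrow> (nat \<Rightarrow> real) measure \<Rightarrow> bool"
  where "weakly_converges k \<mu> \<nu> \<longleftrightarrow>
    (\<forall>\<phi>. continuous_map (product_topology (\<lambda>_. euclideanreal) {..<k}) euclideanreal \<phi> \<longrightarrow>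
         bounded (\<phi> ` ({..<k} \<rightarrow>\<^sub>E UNIV)) \<longrightarrow>
         (\<lambda>N. \<integral>x. \<phi> x \<partial>\<mu> N) \<longlonglongrightarrow> (\<integral>x. \<phi> x \<partial>\<nu>))"

text \<open>For \<open>N < k\<close> the value of \<^const>\<open>marginal\<close> is meaningless, which does not affect the limit.\<close>

definition kac_chaotic :: "(nat \<Rightarrow> (nat \<Rightarrow> real) measure) \<Rightarrow> real measure \<Rightarrow> bool"
  where "kac_chaotic F f \<longleftrightarrow>
    (\<forall>N\<ge>1. prob_measure_n N (F N) \<and> symmetric_measure N (F N)) \<and>
    real_distribution f \<and>
    (\<forall>k. weakly_converges k (\<lambda>N. marginal k (F N)) (tensor_power k f))"

text \<open>
  At the origin the following map takes the value \<open>0\<close>; for \<open>n \<ge> 1\<close> and \<open>f\<close> without an atom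
  at \<open>0\<close> this is a null event of the product measure.
\<close>

definition normalize_to_sphere :: "nat \<Rightarrow> (nat \<Rightarrow> real) \<Rightarrow> (nat \<Rightarrow> real)"
  where "normalize_to_sphere n x = (\<lambda>i\<in>{..<n}. sqrt (real n) / L2_set x {..<n} * x i)"

definition f_hat :: "real measure \<Rightarrow> nat \<Rightarrow> (nat \<Rightarrow> real) measure"
  where "f_hat f n = distr (tensor_power n f) (borel_n n) (normalize_to_sphere n)"

definition couplings :: "'a measure \<Rightarrow> 'b measure \<Rightarrow> ('a \<times> 'b) measure set"
  where "couplings F G =
    {\<pi>. prob_space \<pi> \<and> sets \<pi> = sets (F \<Otimes>\<^sub>M G) \<and> distr \<pi> F fst = F \<and> distr \<pi> G snd = G}"

definition transport_cost2 ::
    "nat \<Rightarrow> (nat \<Rightarrow> real) measure \<Rightarrow> (nat \<Rightarrow> real) measure \<Rightarrow> ennreal"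
  where "transport_cost2 n F G =
    (INF \<pi>\<in>couplings F G.
       \<integral>\<^sup>+ (x, y). ennreal ((L2_set (\<lambda>i. x i - y i) {..<n})\<^sup>2) \<partial>\<pi>)"

text \<open>
  The distance is extended-valued, so that an upper bound on it also asserts that it is finite.
  The case distinction is the square root on \<^typ>\<open>ennreal\<close>.
\<close>

definition W2 :: "nat \<Rightarrow> (nat \<Rightarrow> real) measure \<Rightarrow> (nat \<Rightarrow> real) measure \<Rightarrow> ennreal"
  where "W2 n F G =
    (if transport_cost2 n F G = \<top> then \<top>
     else ennreal (sqrt (enn2real (transport_cost2 n F G))))"

end

theory Submission
  imports Defs
begin

text \<open>
  Let $Q$ be the mean of the squares of the $N$ coordinates of $x$. Coupling $\hat x$ with $x$ gives
  $|\hat x - x|^2 = N (1 - \sqrt Q)^2 \le N |Q - 1|$, so everything rests on a bound for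
  $E|Q - 1|$ under $f^{\otimes N}$. Truncating $x_i^2$ at level $T$, the small part has variance
  at most $E[x^4; x^2 \le T] / N$ and the large part contributes at most $2 E[x^2; x^2 > T]$. With
  $q = \min(p, 4)$, the choice $T = N^{2/q}$ balances the two terms and gives the rate $N^{-(1-2/q)}$.
  For $p = 4$ this is better than claimed by the factor $\log N$, and $C$ absorbs $1 / \log 2$.

  For chaoticity, realise all $f^{\otimes N}$ on one infinite product space. There $Q \to 1$ in $L^1$,
  hence almost surely along a subsequence of any subsequence, and dominated convergence applies.
\<close>

section \<open>Moments of one and two coordinates under product measures\<close>

lemma integral_PiM_component:
  fixes g :: "'a \<Rightarrow> real"
  assumes "\<And>i. i \<in> I \<Longrightarrow> prob_space (M i)" "i \<in> I" "g \<in> borel_measurable (M i)"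
  shows "(\<integral>x. g (x i) \<partial>PiM I M) = (\<integral>x. g x \<partial>M i)"
proof -
  have "(\<integral>x. g x \<partial>M i) = (\<integral>x. g x \<partial>distr (PiM I M) (M i) (\<lambda>x. x i))"
    using assms by (simp add: distr_PiM_component)
  also have "\<dots> = (\<integral>x. g (x i) \<partial>PiM I M)"
    using assms by (intro integral_distr) auto
  finally show ?thesis by simp
qed

lemma integrable_PiM_component:
  fixes g :: "'a \<Rightarrow> real"
  assumes "\<And>i. i \<in> I \<Longrightarrow> prob_space (M i)" "i \<in> I" "integrable (M i) g"
  shows "integrable (PiM I M) (\<lambda>x. g (x i))"
proof -
  have "integrable (distr (PiM I M) (M i) (\<lambda>x. x i)) g"
    using assms by (simp add: distr_PiM_component)
  then show ?thesis
    using assms by (subst (asm) integrable_distr_eq) auto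
qed

lemma
  fixes g :: "'a \<Rightarrow> real"
  assumes "prob_space f" "finite I" "i \<in> I" "j \<in> I" "i \<noteq> j" "integrable f g"
  shows integral_PiM_product2:
      "(\<integral>x. g (x i) * g (x j) \<partial>PiM I (\<lambda>_. f)) = (\<integral>x. g x \<partial>f) * (\<integral>x. g x \<partial>f)"
    and integrable_PiM_product2: "integrable (PiM I (\<lambda>_. f)) (\<lambda>x. g (x i) * g (x j))"
proof -
  interpret prob_space f by fact
  interpret product_sigma_finite "\<lambda>_. f" by unfold_locales
  \<comment> \<open>Filling the remaining coordinates with the constant 1 turns the product of two
    factors into a product over all of \<open>I\<close>, whose integral factorizes; the extra
    factors integrate to 1.\<close>
  let ?F = "\<lambda>k. if k \<in> {i, j} then g else (\<lambda>_. 1)"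
  have eq: "(\<Prod>k\<in>I. ?F k (x k)) = g (x i) * g (x j)" for x
  proof -
    have "(\<Prod>k\<in>I. ?F k (x k)) = (\<Prod>k\<in>{i, j}. ?F k (x k))"
      using assms by (intro prod.mono_neutral_right) auto
    then show ?thesis using assms by simp
  qed
  have int: "integrable f (?F k)" for k using assms by simp
  have "(\<integral>x. (\<Prod>k\<in>I. ?F k (x k)) \<partial>PiM I (\<lambda>_. f)) = (\<Prod>k\<in>I. \<integral>x. ?F k x \<partial>f)"
    using assms int by (intro product_integral_prod) auto
  also have "\<dots> = (\<Prod>k\<in>{i, j}. \<integral>x. ?F k x \<partial>f)"
    using assms by (intro prod.mono_neutral_right) (auto simp: prob_space)
  also have "\<dots> = (\<integral>x. g x \<partial>f) * (\<integral>x. g x \<partial>f)"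
    using assms by simp
  finally show "(\<integral>x. g (x i) * g (x j) \<partial>PiM I (\<lambda>_. f)) = (\<integral>x. g x \<partial>f) * (\<integral>x. g x \<partial>f)"
    by (simp only: eq)
  have "integrable (PiM I (\<lambda>_. f)) (\<lambda>x. \<Prod>k\<in>I. ?F k (x k))"
    using assms int by (intro product_integrable_prod) auto
  then show "integrable (PiM I (\<lambda>_. f)) (\<lambda>x. g (x i) * g (x j))"
    by (simp only: eq)
qed

text \<open>Expanding the square, each off-diagonal term is a product of two zero means by
  independence, so that only the \<open>card I\<close> diagonal terms survive.\<close>

lemma
  fixes g :: "'a \<Rightarrow> real"
  assumes f: "prob_space f" and "finite I" and g: "integrable f g" "integrable f (\<lambda>x. (g x)\<^sup>2)"
    and centred: "(\<integral>x. g x \<partial>f) = 0"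
  shows integral_square_sum_centred:
      "(\<integral>x. (\<Sum>i\<in>I. g (x i))\<^sup>2 \<partial>PiM I (\<lambda>_. f)) = card I * (\<integral>x. (g x)\<^sup>2 \<partial>f)"
    and integrable_square_sum: "integrable (PiM I (\<lambda>_. f)) (\<lambda>x. (\<Sum>i\<in>I. g (x i))\<^sup>2)"
proof -
  have sq: "(\<Sum>i\<in>I. g (x i))\<^sup>2 = (\<Sum>i\<in>I. \<Sum>j\<in>I. g (x i) * g (x j))" for x
    by (simp add: power2_eq_square sum_product)
  have int: "integrable (PiM I (\<lambda>_. f)) (\<lambda>x. g (x i) * g (x j))" if "i \<in> I" "j \<in> I" for i j
  proof (cases "i = j")
    case True
    show ?thesis
      using integrable_PiM_component[of I "\<lambda>_. f" i "\<lambda>x. (g x)\<^sup>2"] f g that True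
      by (simp add: power2_eq_square)
  next
    case False
    then show ?thesis using assms that by (intro integrable_PiM_product2)
  qed
  show "integrable (PiM I (\<lambda>_. f)) (\<lambda>x. (\<Sum>i\<in>I. g (x i))\<^sup>2)"
    unfolding sq using int by (intro Bochner_Integration.integrable_sum)
  have val: "(\<integral>x. g (x i) * g (x j) \<partial>PiM I (\<lambda>_. f)) = (if i = j then \<integral>x. (g x)\<^sup>2 \<partial>f else 0)"
    if "i \<in> I" "j \<in> I" for i j
    using integral_PiM_component[of I "\<lambda>_. f" i "\<lambda>x. (g x)\<^sup>2"] f g that
      integral_PiM_product2[OF f \<open>finite I\<close> that _ g(1)] centred
    by (auto simp: power2_eq_square)
  have "(\<integral>x. (\<Sum>i\<in>I. g (x i))\<^sup>2 \<partial>PiM I (\<lambda>_. f))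
      = (\<Sum>i\<in>I. \<Sum>j\<in>I. \<integral>x. g (x i) * g (x j) \<partial>PiM I (\<lambda>_. f))"
    unfolding sq using int
    by (subst Bochner_Integration.integral_sum, intro Bochner_Integration.integrable_sum)
      (auto simp: Bochner_Integration.integral_sum)
  also have "\<dots> = (\<Sum>i\<in>I. \<integral>x. (g x)\<^sup>2 \<partial>f)"
    using \<open>finite I\<close> by (intro sum.cong refl) (simp add: val)
  finally show "(\<integral>x. (\<Sum>i\<in>I. g (x i))\<^sup>2 \<partial>PiM I (\<lambda>_. f)) = card I * (\<integral>x. (g x)\<^sup>2 \<partial>f)"
    by simp
qed

section \<open>Truncation and the deviation of empirical means in L1\<close>

text \<open>The inequality is the nonnegativity of the variance of |X|.\<close>

lemma (in prob_space) expectation_abs_le_sqrt: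
  fixes X :: "'a \<Rightarrow> real"
  assumes "integrable M X" "integrable M (\<lambda>x. (X x)\<^sup>2)"
  shows "expectation (\<lambda>x. \<bar>X x\<bar>) \<le> sqrt (expectation (\<lambda>x. (X x)\<^sup>2))"
proof -
  have "0 \<le> variance (\<lambda>x. \<bar>X x\<bar>)" by (rule variance_positive)
  also have "\<dots> = expectation (\<lambda>x. (X x)\<^sup>2) - (expectation (\<lambda>x. \<bar>X x\<bar>))\<^sup>2"
    using assms by (subst variance_eq) auto
  finally show ?thesis by (intro real_le_rsqrt) simp
qed

definition tail_mean :: "real measure \<Rightarrow> (real \<Rightarrow> real) \<Rightarrow> real \<Rightarrow> real"
  where "tail_mean f h T = (\<integral>x. (if h x \<le> T then 0 else h x) \<partial>f)"

text \<open>Split h = g + r at the level T. The bounded part g has a second moment, so its centred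
  empirical mean is controlled by its variance. For r only a first moment is at hand: its empirical
  mean and its expectation are bounded separately, which gives the factor 2. The level T is left
  free: a fixed T yields convergence, a T growing with N yields rates.\<close>

lemma empirical_mean_deviation:
  fixes h :: "real \<Rightarrow> real"
  assumes f: "prob_space f" and h: "integrable f h" "\<And>x. h x \<ge> 0" and N: "N \<ge> 1"
  shows "(\<integral>x. \<bar>(\<Sum>i<N. h (x i)) / N - (\<integral>y. h y \<partial>f)\<bar> \<partial>tensor_power N f)
    \<le> 2 * tail_mean f h T + sqrt ((\<integral>x. (if h x \<le> T then (h x)\<^sup>2 else 0) \<partial>f) / N)"
proof -
  interpret f: prob_space f by fact
  interpret P: prob_space "tensor_power N f" using f by (intro prob_space_PiM)
  note [measurable] = borel_measurable_integrable[OF h(1)]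
  define g where "g x = (if h x \<le> T then h x else 0)" for x
  define r where "r x = (if h x \<le> T then 0 else h x)" for x
  have [measurable]: "g \<in> borel_measurable f" "r \<in> borel_measurable f"
    unfolding g_def[abs_def] r_def[abs_def] by measurable
  have hgr: "h x = g x + r x" and r0: "r x \<ge> 0" for x using h(2)[of x] by (auto simp: g_def r_def)
  have gi: "integrable f g" and ri: "integrable f r"
    using h(2) by (auto intro!: Bochner_Integration.integrable_bound[OF h(1)] simp: g_def r_def)
  have g2: "integrable f (\<lambda>x. (g x)\<^sup>2)"
  proof (rule f.integrable_const_bound[where B="T\<^sup>2"])
    show "AE x in f. norm ((g x)\<^sup>2) \<le> T\<^sup>2"
      using h(2) by (auto simp: g_def intro!: power_mono)
  qed simp
  define c where "c = (\<integral>x. g x \<partial>f)"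
  define d where "d = (\<integral>x. r x \<partial>f)"
  define g0 where "g0 x = g x - c" for x
  have d0: "d \<ge> 0" unfolding d_def using r0 by simp
  have g0i: "integrable f g0" "integrable f (\<lambda>x. (g0 x)\<^sup>2)" "(\<integral>x. g0 x \<partial>f) = 0"
    using gi g2 by (auto simp: g0_def[abs_def] power2_diff c_def f.prob_space)
  \<comment> \<open>Passing from the variance to the raw second moment removes the centring constant
    c from the final bound.\<close>
  have "(\<integral>x. (g0 x)\<^sup>2 \<partial>f) = (\<integral>x. (g x)\<^sup>2 \<partial>f) - c\<^sup>2"
    unfolding g0_def c_def using gi g2 by (rule f.variance_eq)
  then have g0g: "(\<integral>x. (g0 x)\<^sup>2 \<partial>f) \<le> (\<integral>x. (g x)\<^sup>2 \<partial>f)" by simp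
  have Eh: "(\<integral>y. h y \<partial>f) = c + d"
    unfolding hgr c_def d_def using gi ri by (rule Bochner_Integration.integral_add)
  have comp: "integrable (tensor_power N f) (\<lambda>x. u (x i))"
    "(\<integral>x. u (x i) \<partial>tensor_power N f) = (\<integral>x. u x \<partial>f)"
    if "integrable f u" "i < N" for u :: "real \<Rightarrow> real" and i
    using that f integrable_PiM_component[of "{..<N}" "\<lambda>_. f" i u]
      integral_PiM_component[of "{..<N}" "\<lambda>_. f" i u] by auto
  let ?A = "\<lambda>x. \<bar>\<Sum>i<N. g0 (x i)\<bar> / N" and ?B = "\<lambda>x. (\<Sum>i<N. r (x i)) / N + d"
  have Ai: "integrable (tensor_power N f) (\<lambda>x. \<Sum>i<N. g0 (x i))"
    using comp g0i by (intro Bochner_Integration.integrable_sum) auto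
  have Bi: "integrable (tensor_power N f) (\<lambda>x. \<Sum>i<N. r (x i))"
    using comp ri by (intro Bochner_Integration.integrable_sum) auto
  have hi: "integrable (tensor_power N f) (\<lambda>x. \<Sum>i<N. h (x i))"
    using comp h by (intro Bochner_Integration.integrable_sum) auto
  have "(\<integral>x. \<bar>\<Sum>i<N. g0 (x i)\<bar> \<partial>tensor_power N f) \<le> sqrt (N * (\<integral>x. (g0 x)\<^sup>2 \<partial>f))"
    using P.expectation_abs_le_sqrt[OF Ai]
      integral_square_sum_centred[OF f _ g0i, of "{..<N}"] integrable_square_sum[OF f _ g0i, of "{..<N}"]
    by simp
  also have "\<dots> \<le> sqrt (N * (\<integral>x. (g x)\<^sup>2 \<partial>f))"
    using g0g by (intro real_sqrt_le_mono mult_left_mono) auto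
  finally have "(\<integral>x. ?A x \<partial>tensor_power N f) \<le> sqrt (N * (\<integral>x. (g x)\<^sup>2 \<partial>f)) / N"
    using N by (simp add: divide_right_mono)
  also have "\<dots> = sqrt ((\<integral>x. (g x)\<^sup>2 \<partial>f) / N)"
    using N by (simp add: real_sqrt_mult real_sqrt_divide field_simps)
  finally have A: "(\<integral>x. ?A x \<partial>tensor_power N f) \<le> sqrt ((\<integral>x. (g x)\<^sup>2 \<partial>f) / N)" .
  have B: "(\<integral>x. ?B x \<partial>tensor_power N f) = 2 * d"
    using N Bi comp[OF ri]
    by (simp add: P.prob_space Bochner_Integration.integral_sum d_def)
  have "(\<integral>x. \<bar>(\<Sum>i<N. h (x i)) / N - (\<integral>y. h y \<partial>f)\<bar> \<partial>tensor_power N f)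
      \<le> (\<integral>x. ?A x + ?B x \<partial>tensor_power N f)"
  proof (rule integral_mono)
    fix x
    have "(\<Sum>i<N. h (x i)) / N - (c + d) = (\<Sum>i<N. g0 (x i)) / N + ((\<Sum>i<N. r (x i)) / N - d)"
      using N by (simp add: hgr g0_def sum.distrib sum_subtractf field_simps)
    also have "\<bar>\<dots>\<bar> \<le> \<bar>(\<Sum>i<N. g0 (x i)) / N\<bar> + \<bar>(\<Sum>i<N. r (x i)) / N - d\<bar>"
      by (rule abs_triangle_ineq)
    \<comment> \<open>Both terms are nonnegative, so their difference is at most their sum in
      absolute value; no cancellation is sought here.\<close>
    also have "\<bar>(\<Sum>i<N. r (x i)) / N - d\<bar> \<le> ?B x"
      using d0 sum_nonneg[of "{..<N}" "\<lambda>i. r (x i)"] r0 by (simp add: abs_le_iff)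
    finally show "\<bar>(\<Sum>i<N. h (x i)) / N - (\<integral>y. h y \<partial>f)\<bar> \<le> ?A x + ?B x"
      by (simp add: Eh)
  qed (use Ai Bi hi in auto)
  also have "\<dots> = (\<integral>x. ?A x \<partial>tensor_power N f) + (\<integral>x. ?B x \<partial>tensor_power N f)"
    using Ai Bi by (intro Bochner_Integration.integral_add) auto
  finally have "(\<integral>x. \<bar>(\<Sum>i<N. h (x i)) / N - (\<integral>y. h y \<partial>f)\<bar> \<partial>tensor_power N f)
      \<le> 2 * d + sqrt ((\<integral>x. (g x)\<^sup>2 \<partial>f) / N)"
    using A B by simp
  also have "(\<lambda>x. (g x)\<^sup>2) = (\<lambda>x. if h x \<le> T then (h x)\<^sup>2 else 0)"
    by (auto simp: g_def)
  finally show ?thesis by (simp add: d_def r_def[abs_def] tail_mean_def)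
qed

section \<open>Convergence of the mean square to 1 in L1\<close>

abbreviation mean_square :: "nat \<Rightarrow> (nat \<Rightarrow> real) \<Rightarrow> real"
  where "mean_square n x \<equiv> (\<Sum>i<n. (x i)\<^sup>2) / real n"

lemma measurable_normalize_to_sphere:
  assumes "sets f = sets borel"
  shows "normalize_to_sphere n \<in> tensor_power n f \<rightarrow>\<^sub>M borel_n n"
proof -
  note [measurable_cong] = assms
  show ?thesis
    unfolding normalize_to_sphere_def[abs_def] L2_set_def by measurable
qed

text \<open>For each x the integrand vanishes as soon as T reaches h x, and h itself
  dominates.\<close>

lemma tail_mean_tendsto_0:
  assumes "integrable f h" "\<And>x. h x \<ge> 0"
  shows "(tail_mean f h \<longlongrightarrow> 0) at_top"
proof -
  note [measurable] = borel_measurable_integrable[OF assms(1)]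
  have "((\<lambda>T. \<integral>x. (if h x \<le> T then 0 else h x) \<partial>f) \<longlongrightarrow> (\<integral>x. 0 \<partial>f)) at_top"
  proof (rule integral_dominated_convergence_at_top[where w=h])
    have "eventually (\<lambda>T. (if h x \<le> T then 0 else h x) = 0) at_top" for x
      using eventually_ge_at_top[of "h x"] by eventually_elim auto
    then show "AE x in f. ((\<lambda>T. if h x \<le> T then 0 else h x) \<longlongrightarrow> 0) at_top"
      by (auto intro: tendsto_eventually)
  qed (use assms in auto)
  then show ?thesis by (simp add: tail_mean_def[abs_def])
qed

text \<open>This is a law of large numbers for x^2 with a first moment of x^2 only. First T is fixed
  so that the tail term is below e/2 (hence e/4 before doubling); then n is taken large, the
  truncated fourth moment c being independent of n.\<close>

lemma mean_square_tendsto_L1: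
  assumes f: "prob_space f" and f2: "integrable f (\<lambda>x. x\<^sup>2)" "(\<integral>x. x\<^sup>2 \<partial>f) = 1"
  shows "(\<lambda>n. \<integral>x. \<bar>mean_square n x - 1\<bar> \<partial>tensor_power n f) \<longlonglongrightarrow> 0"
proof (rule tendstoI)
  fix e :: real assume e: "e > 0"
  have "eventually (\<lambda>T. tail_mean f (\<lambda>x. x\<^sup>2) T < e / 4) at_top"
    using tail_mean_tendsto_0[OF f2(1)] e by (intro order_tendstoD(2)) auto
  then obtain T where T: "tail_mean f (\<lambda>x. x\<^sup>2) T < e / 4"
    using eventually_happens'[OF trivial_limit_at_top_linorder] by blast
  define c where "c = (\<integral>x. (if x\<^sup>2 \<le> T then (x\<^sup>2)\<^sup>2 else 0) \<partial>f)"
  have "(\<lambda>n. sqrt (c / real n)) \<longlonglongrightarrow> sqrt 0"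
    by (intro tendsto_real_sqrt lim_const_over_n)
  then have "eventually (\<lambda>n. sqrt (c / real n) < e / 2) sequentially"
    using e by (intro order_tendstoD(2)) auto
  with eventually_ge_at_top[of 1]
  show "\<forall>\<^sub>F n in sequentially. dist (\<integral>x. \<bar>mean_square n x - 1\<bar> \<partial>tensor_power n f) 0 < e"
  proof eventually_elim
    case (elim n)
    then show ?case
      using empirical_mean_deviation[OF f f2(1) _ elim(1), of T] T
      by (simp add: f2(2) c_def)
  qed
qed

section \<open>Weak convergence of marginals and Kac chaoticity\<close>

text \<open>If convergence failed, infinitely many indices would stay at distance at least e from L;
  enumerating them gives a subsequence without any further subsequence tending to L.\<close>

lemma LIMSEQ_subsubseqI:
  fixes X :: "nat \<Rightarrow> 'a::metric_space"
  assumes "\<And>r. strict_mono r \<Longrightarrow> \<exists>s. strict_mono (s :: nat \<Rightarrow> nat) \<and> (\<lambda>n. X (r (s n))) \<longlonglongrightarrow> L"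
  shows "X \<longlonglongrightarrow> L"
proof (rule tendstoI, rule ccontr)
  fix e :: real assume e: "e > 0" and "\<not> (\<forall>\<^sub>F n in sequentially. dist (X n) L < e)"
  then have "infinite {n. \<not> dist (X n) L < e}"
    by (simp add: not_eventually frequently_cofinite flip: cofinite_eq_sequentially)
  then obtain r :: "nat \<Rightarrow> nat" where r: "strict_mono r" "\<And>n. \<not> dist (X (r n)) L < e"
    using infinite_enumerate by blast
  obtain s :: "nat \<Rightarrow> nat" where "(\<lambda>n. X (r (s n))) \<longlonglongrightarrow> L"
    using assms[OF r(1)] by blast
  then have "\<forall>\<^sub>F n in sequentially. dist (X (r (s n))) L < e"
    using e by (rule tendstoD)
  with r(2) show False by simp
qed

text \<open>On the full function space the product topology is that of the type, and for countably
  many coordinates its Borel sets are those of the product measure. So \<phi> is first extended to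
  all functions by restricting their argument to \<open>I\<close>, and then pulled back.\<close>

lemma continuous_map_borel_measurable_PiM:
  fixes \<phi> :: "('i::countable \<Rightarrow> real) \<Rightarrow> real"
  assumes "continuous_map (product_topology (\<lambda>_. euclideanreal) I) euclideanreal \<phi>"
  shows "\<phi> \<in> borel_measurable (PiM I (\<lambda>_. borel))"
proof -
  define \<psi> where "\<psi> x = \<phi> (restrict x I)" for x
  have "continuous_map (product_topology (\<lambda>_. euclideanreal) UNIV)
      (product_topology (\<lambda>_. euclideanreal) I) (\<lambda>x::'i \<Rightarrow> real. restrict x I)"
    by (auto simp: continuous_map_componentwise intro: continuous_map_product_projection)
  from continuous_map_compose[OF this assms] have "continuous_on UNIV \<psi>"
    by (simp add: euclidean_product_topology \<psi>_def[abs_def] comp_def)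
  then have "\<psi> \<in> borel_measurable borel"
    by (rule borel_measurable_continuous_onI)
  then have [measurable]: "\<psi> \<in> borel_measurable (PiM UNIV (\<lambda>_. borel))"
    using measurable_cong_sets[OF sets_PiM_equal_borel refl] by blast
  \<comment> \<open>Padding by 0 leads from functions on \<open>I\<close> to total functions; the
    restriction inside \<psi> discards the padding again.\<close>
  have [measurable]: "(\<lambda>x i. if i \<in> I then x i else 0) \<in> PiM I (\<lambda>_. borel) \<rightarrow>\<^sub>M PiM UNIV (\<lambda>_. borel :: real measure)"
  proof (rule measurable_abs_UNIV)
    fix i show "(\<lambda>x. if i \<in> I then x i else 0) \<in> PiM I (\<lambda>_. borel) \<rightarrow>\<^sub>M (borel :: real measure)"
      by (cases "i \<in> I") auto
  qed
  have "(\<lambda>x. \<psi> (\<lambda>i. if i \<in> I then x i else 0)) \<in> borel_measurable (PiM I (\<lambda>_. borel))"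
    by measurable
  moreover have "\<psi> (\<lambda>i. if i \<in> I then x i else 0) = \<phi> x" if "x \<in> space (PiM I (\<lambda>_. borel))" for x
    using that unfolding \<psi>_def
    by (intro arg_cong[where f=\<phi>]) (auto simp: space_PiM restrict_def PiE_def extensional_def fun_eq_iff)
  ultimately show ?thesis
    using measurable_cong[of "PiM I (\<lambda>_. borel)" "\<lambda>x. \<psi> (\<lambda>i. if i \<in> I then x i else 0)" \<phi>]
    by blast
qed

text \<open>The Euclidean norm ignores the order of the coordinates, so normalizing commutes with
  permuting them, and the product measure is itself invariant.\<close>

lemma symmetric_measure_f_hat:
  assumes f: "prob_space f" "sets f = sets borel"
  shows "symmetric_measure n (f_hat f n)"
  unfolding symmetric_measure_def
proof (intro allI impI)
  fix \<sigma> assume \<sigma>: "\<sigma> permutes {..<n}"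
  let ?T = "tensor_power n f" and ?p = "\<lambda>x. \<lambda>i\<in>{..<n}. x (\<sigma> i) :: real"
  note [measurable_cong] = f(2)
  note [measurable] = measurable_normalize_to_sphere[OF f(2), of n]
  have in_n: "\<sigma> i < n" if "i < n" for i using permutes_in_image[OF \<sigma>] that by auto
  have pT: "?p \<in> ?T \<rightarrow>\<^sub>M ?T" and pB: "?p \<in> borel_n n \<rightarrow>\<^sub>M borel_n n"
    using in_n by (auto intro!: measurable_restrict measurable_component_singleton)
  have L2: "L2_set (?p x) {..<n} = L2_set x {..<n}" for x
    unfolding L2_set_def using sum.permute[OF \<sigma>, of "\<lambda>i. (x i)\<^sup>2"] by (simp add: comp_def)
  have comm: "?p (normalize_to_sphere n x) = normalize_to_sphere n (?p x)" for x
    unfolding normalize_to_sphere_def L2 using in_n by (auto intro!: restrict_ext)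
  have "distr (f_hat f n) (borel_n n) ?p = distr ?T (borel_n n) (\<lambda>x. normalize_to_sphere n (?p x))"
    unfolding f_hat_def using pB by (subst distr_distr) (auto simp: comp_def comm)
  also have "\<dots> = distr (distr ?T ?T ?p) (borel_n n) (normalize_to_sphere n)"
    using pT by (subst distr_distr) (auto simp: comp_def)
  also have "distr ?T ?T ?p = ?T"
    using distr_PiM_reindex[of "{..<n}" "\<lambda>_. f" \<sigma> "{..<n}"] f in_n permutes_inj_on[OF \<sigma>] by auto
  finally show "distr (f_hat f n) (borel_n n) ?p = f_hat f n"
    by (simp only: f_hat_def)
qed

lemma kac_chaotic_f_hat:
  assumes f: "real_distribution f" and f2: "integrable f (\<lambda>x. x\<^sup>2)" "(\<integral>x. x\<^sup>2 \<partial>f) = 1"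
  shows "kac_chaotic (f_hat f) f"
  unfolding kac_chaotic_def weakly_converges_def
proof (intro conjI allI impI f)
  interpret f: real_distribution f by fact
  have fp: "prob_space f" by unfold_locales
  have fb: "sets f = sets borel" by simp
  note [measurable] = measurable_normalize_to_sphere[OF fb]
  show "prob_measure_n n (f_hat f n)" for n
  proof -
    interpret prob_space "tensor_power n f" using fp by (rule prob_space_PiM)
    show ?thesis unfolding prob_measure_n_def f_hat_def by (auto intro!: prob_space_distr)
  qed
  show "symmetric_measure n (f_hat f n)" for n
    using fp fb by (rule symmetric_measure_f_hat)

  fix k and \<phi> :: "(nat \<Rightarrow> real) \<Rightarrow> real"
  assume \<phi>: "continuous_map (product_topology (\<lambda>_. euclideanreal) {..<k}) euclideanreal \<phi>"
    and "bounded (\<phi> ` ({..<k} \<rightarrow>\<^sub>E UNIV))"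
  then obtain B where B: "\<bar>\<phi> x\<bar> \<le> B" if "x \<in> {..<k} \<rightarrow>\<^sub>E UNIV" for x
    by (auto simp: bounded_iff)
  have [measurable]: "\<phi> \<in> borel_measurable (borel_n k)"
    using \<phi> by (rule continuous_map_borel_measurable_PiM)

  let ?\<Omega> = "PiM (UNIV :: nat set) (\<lambda>_. f)"
  interpret \<Omega>: prob_space ?\<Omega> using fp by (rule prob_space_PiM)
  \<comment> \<open>The first n coordinates of an infinite sequence have law f^n, so integrals for
    all n can be compared on the one space \<open>?\<Omega>\<close>.\<close>
  have restr: "tensor_power n f = distr ?\<Omega> (tensor_power n f) (\<lambda>x. restrict x {..<n})" for n
    using distr_PiM_reindex[of UNIV "\<lambda>_. f" "\<lambda>i. i" "{..<n}"] fp by (auto simp: restrict_def)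
  have restr_m[measurable]: "(\<lambda>x. restrict x {..<n}) \<in> ?\<Omega> \<rightarrow>\<^sub>M tensor_power n f" for n
    by measurable

  \<comment> \<open>These are the first k coordinates of the normalized vector, since sqrt n / |x| =
    1 / sqrt (mean square); where the mean square is 0, division by zero makes both factors 0. The
    agreement needs n >= k, so that all k coordinates are present.\<close>
  define scaled where "scaled n x = (\<lambda>i\<in>{..<k}. 1 / sqrt (mean_square n x) * x i)" for n x
  have [measurable]: "scaled n \<in> ?\<Omega> \<rightarrow>\<^sub>M borel_n k" for n
    unfolding scaled_def[abs_def] by measurable
  have marg: "(\<integral>x. \<phi> x \<partial>marginal k (f_hat f n)) = (\<integral>x. \<phi> (scaled n x) \<partial>?\<Omega>)" if "n \<ge> k" "n \<ge> 1" for n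
  proof -
    have [measurable]: "(\<lambda>x. restrict x {..<k}) \<in> borel_n n \<rightarrow>\<^sub>M borel_n k"
      using that by (intro measurable_restrict_subset) auto
    have scaled: "restrict (normalize_to_sphere n (restrict x {..<n})) {..<k} = scaled n x" for x
    proof -
      have "L2_set (restrict x {..<n}) {..<n} = L2_set x {..<n}"
        by (rule L2_set_cong) auto
      then show ?thesis
        using that unfolding normalize_to_sphere_def scaled_def
        by (auto simp: L2_set_def real_sqrt_divide restrict_def fun_eq_iff)
    qed
    have "(\<integral>x. \<phi> x \<partial>marginal k (f_hat f n))
        = (\<integral>x. \<phi> (restrict (normalize_to_sphere n x) {..<k}) \<partial>tensor_power n f)"
      unfolding marginal_def f_hat_def by (subst integral_distr, simp, simp)+ simp
    also have "\<dots> = (\<integral>x. \<phi> (restrict (normalize_to_sphere n (restrict x {..<n})) {..<k}) \<partial>?\<Omega>)"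
      by (subst restr, subst integral_distr) auto
    also have "\<dots> = (\<integral>x. \<phi> (scaled n x) \<partial>?\<Omega>)"
      by (simp only: scaled)
    finally show ?thesis .
  qed
  have lim: "(\<integral>x. \<phi> x \<partial>tensor_power k f) = (\<integral>x. \<phi> (restrict x {..<k}) \<partial>?\<Omega>)"
    by (subst restr, subst integral_distr) auto

  define u where "u n x = mean_square n x - 1" for n x
  have u_int: "integrable ?\<Omega> (u n)" for n
    unfolding u_def[abs_def] using f2 fp
      integrable_PiM_component[of UNIV "\<lambda>_. f" _ "\<lambda>x. x\<^sup>2"]
    by (intro Bochner_Integration.integrable_diff integrable_divide
        Bochner_Integration.integrable_sum) auto
  have "(\<integral>x. norm (u n x) \<partial>?\<Omega>) = (\<integral>x. \<bar>mean_square n x - 1\<bar> \<partial>tensor_power n f)" for n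
    by (subst restr, subst integral_distr) (auto simp: u_def)
  then have u_lim: "(\<lambda>n. \<integral>x. norm (u n x) \<partial>?\<Omega>) \<longlonglongrightarrow> 0"
    using mean_square_tendsto_L1[OF fp f2] by simp

  have "(\<lambda>n. \<integral>x. \<phi> (scaled n x) \<partial>?\<Omega>) \<longlonglongrightarrow> (\<integral>x. \<phi> (restrict x {..<k}) \<partial>?\<Omega>)"
  proof (rule LIMSEQ_subsubseqI)
    fix r :: "nat \<Rightarrow> nat" assume "strict_mono r"
    then have "(\<lambda>n. \<integral>x. norm (u (r n) x) \<partial>?\<Omega>) \<longlonglongrightarrow> 0"
      using LIMSEQ_subseq_LIMSEQ[OF u_lim] by (simp add: comp_def)
    from tendsto_L1_AE_subseq[OF u_int this]
    obtain s :: "nat \<Rightarrow> nat"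
      where s: "strict_mono s" "AE x in ?\<Omega>. (\<lambda>n. u (r (s n)) x) \<longlonglongrightarrow> 0" by blast
    have "(\<lambda>n. \<integral>x. \<phi> (scaled (r (s n)) x) \<partial>?\<Omega>) \<longlonglongrightarrow> (\<integral>x. \<phi> (restrict x {..<k}) \<partial>?\<Omega>)"
    proof (rule integral_dominated_convergence[where w="\<lambda>_. B"])
      show "AE x in ?\<Omega>. (\<lambda>n. \<phi> (scaled (r (s n)) x)) \<longlonglongrightarrow> \<phi> (restrict x {..<k})"
        using s(2)
      proof eventually_elim
        case (elim x)
        \<comment> \<open>For fixed x only the scalar factor depends on n. Hence it is enough that t
          \<mapsto> \<phi>(t x) is continuous at 1 and that the factor tends to 1.\<close>
        have "continuous_map euclideanreal (product_topology (\<lambda>_. euclideanreal) {..<k})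
            (\<lambda>t. \<lambda>i\<in>{..<k}. t * x i)"
          by (auto simp: continuous_map_componentwise intro!: continuous_intros)
        from continuous_map_compose[OF this \<phi>]
        have "isCont (\<lambda>t. \<phi> (\<lambda>i\<in>{..<k}. t * x i)) 1"
          by (simp add: comp_def continuous_on_eq_continuous_at)
        moreover have "(\<lambda>n. 1 / sqrt (u (r (s n)) x + 1)) \<longlonglongrightarrow> 1 / sqrt (0 + 1)"
          using elim by (intro tendsto_intros) auto
        ultimately have "(\<lambda>n. \<phi> (\<lambda>i\<in>{..<k}. 1 / sqrt (u (r (s n)) x + 1) * x i))
            \<longlonglongrightarrow> \<phi> (\<lambda>i\<in>{..<k}. 1 * x i)"
          by (intro isCont_tendsto_compose[of 1 "\<lambda>t. \<phi> (\<lambda>i\<in>{..<k}. t * x i)"]) auto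
        then show ?case
          by (simp add: u_def scaled_def restrict_def)
      qed
      \<comment> \<open>The bound B is known only for extensional arguments; \<open>scaled\<close>
        is one by its restriction.\<close>
      have "\<bar>\<phi> (scaled (r (s n)) x)\<bar> \<le> B" for n x
        by (rule B) (simp add: scaled_def)
      then show "AE x in ?\<Omega>. norm (\<phi> (scaled (r (s n)) x)) \<le> B" for n
        by simp
    qed auto
    with s(1) show "\<exists>s. strict_mono (s :: nat \<Rightarrow> nat) \<and>
        (\<lambda>n. \<integral>x. \<phi> (scaled (r (s n)) x) \<partial>?\<Omega>) \<longlonglongrightarrow> (\<integral>x. \<phi> (restrict x {..<k}) \<partial>?\<Omega>)"
      by blast
  qed
  moreover have "\<forall>\<^sub>F n in sequentially.
      (\<integral>x. \<phi> (scaled n x) \<partial>?\<Omega>) = (\<integral>x. \<phi> x \<partial>marginal k (f_hat f n))"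
    using eventually_ge_at_top[of "max 1 k"] by eventually_elim (simp add: marg)
  ultimately show "(\<lambda>n. \<integral>x. \<phi> x \<partial>marginal k (f_hat f n)) \<longlonglongrightarrow> (\<integral>x. \<phi> x \<partial>tensor_power k f)"
    unfolding lim by (rule Lim_transform_eventually)
qed

section \<open>Transport cost of the radial coupling\<close>

text \<open>The displacement is radial, of length |s - sqrt n| with s = |x| if x is nonzero.
  Replacing one of the two factors of its square by the larger s + sqrt n gives |s^2 - n|.\<close>

lemma dist_normalize_to_sphere_le:
  assumes "n \<ge> 1"
  shows "(L2_set (\<lambda>i. normalize_to_sphere n x i - x i) {..<n})\<^sup>2 \<le> real n * \<bar>mean_square n x - 1\<bar>"
proof -
  define s where "s = L2_set x {..<n}"
  have s2: "s\<^sup>2 = (\<Sum>i<n. (x i)\<^sup>2)" by (simp add: s_def L2_set_def sum_nonneg)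
  have s0: "s \<ge> 0" by (simp add: s_def)
  have "(L2_set (\<lambda>i. normalize_to_sphere n x i - x i) {..<n})\<^sup>2
      = (\<Sum>i<n. ((sqrt n / s - 1) * x i)\<^sup>2)"
    unfolding L2_set_def
    by (subst real_sqrt_pow2) (auto simp: sum_nonneg normalize_to_sphere_def s_def algebra_simps)
  also have "\<dots> = ((sqrt n / s - 1) * s)\<^sup>2"
    by (simp add: power_mult_distrib s2 sum_distrib_left)
  also have "\<dots> \<le> \<bar>s\<^sup>2 - n\<bar>"
  proof (cases "s = 0")
    case False
    then have "((sqrt n / s - 1) * s)\<^sup>2 = \<bar>s - sqrt n\<bar> * \<bar>s - sqrt n\<bar>"
      by (simp add: power2_eq_square algebra_simps)
    also have "\<dots> \<le> \<bar>s - sqrt n\<bar> * \<bar>s + sqrt n\<bar>"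
      using s0 real_sqrt_ge_zero[of "real n"] by (intro mult_left_mono) linarith+
    also have "\<dots> = \<bar>s\<^sup>2 - n\<bar>"
      unfolding abs_mult[symmetric] by (simp add: algebra_simps power2_eq_square)
    finally show ?thesis .
  \<comment> \<open>For s = 0 the left side is 0, in accordance with the value of the normalization
    at the origin.\<close>
  qed simp
  also have "\<dots> = real n * \<bar>mean_square n x - 1\<bar>"
  proof -
    have "real n * \<bar>mean_square n x - 1\<bar> = \<bar>real n * (mean_square n x - 1)\<bar>"
      by (simp add: abs_mult)
    also have "real n * (mean_square n x - 1) = s\<^sup>2 - n"
      using assms by (simp add: s2 field_simps)
    finally show ?thesis by simp
  qed
  finally show ?thesis .
qed

lemma transport_cost2_f_hat_le:
  assumes f: "prob_space f" "sets f = sets borel" "integrable f (\<lambda>x. x\<^sup>2)" and n: "n \<ge> 1"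
  shows "transport_cost2 n (f_hat f n) (tensor_power n f)
    \<le> ennreal (real n * (\<integral>x. \<bar>mean_square n x - 1\<bar> \<partial>tensor_power n f))"
proof -
  interpret P: prob_space "tensor_power n f" using f by (intro prob_space_PiM)
  note [measurable_cong] = f(2)
  note [measurable] = measurable_normalize_to_sphere[OF f(2), of n]
  let ?P = "tensor_power n f"
  \<comment> \<open>The coupling is the joint law of the normalized vector and the vector itself;
    its cost bounds the infimum.\<close>
  define \<pi> where "\<pi> = distr ?P (f_hat f n \<Otimes>\<^sub>M ?P) (\<lambda>x. (normalize_to_sphere n x, x))"
  have F: "f_hat f n = distr ?P (borel_n n) (normalize_to_sphere n)" by (simp add: f_hat_def)
  have sF[measurable_cong]: "sets (f_hat f n) = sets (borel_n n)" by (simp add: f_hat_def)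
  have m[measurable]: "(\<lambda>x. (normalize_to_sphere n x, x)) \<in> ?P \<rightarrow>\<^sub>M (f_hat f n \<Otimes>\<^sub>M ?P)"
    by measurable
  have "\<pi> \<in> couplings (f_hat f n) ?P"
  proof -
    have "distr \<pi> (f_hat f n) fst = distr ?P (f_hat f n) (normalize_to_sphere n)"
      unfolding \<pi>_def by (subst distr_distr) (auto simp: comp_def)
    also have "\<dots> = f_hat f n"
      unfolding F by (rule distr_cong) auto
    finally have 1: "distr \<pi> (f_hat f n) fst = f_hat f n" .
    have 2: "distr \<pi> ?P snd = ?P"
      unfolding \<pi>_def by (subst distr_distr) (auto simp: comp_def distr_id)
    show ?thesis
      using 1 2 P.prob_space_distr[OF m] by (auto simp: couplings_def \<pi>_def)
  qed
  then have "transport_cost2 n (f_hat f n) ?P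
      \<le> (\<integral>\<^sup>+ (x, y). ennreal ((L2_set (\<lambda>i. x i - y i) {..<n})\<^sup>2) \<partial>\<pi>)"
    unfolding transport_cost2_def by (rule INF_lower)
  also have "\<dots> = (\<integral>\<^sup>+ x. ennreal ((L2_set (\<lambda>i. normalize_to_sphere n x i - x i) {..<n})\<^sup>2) \<partial>?P)"
  proof -
    have "(\<lambda>(x, y). ennreal ((L2_set (\<lambda>i. x i - y i) {..<n})\<^sup>2))
        \<in> borel_measurable (f_hat f n \<Otimes>\<^sub>M ?P)"
      unfolding L2_set_def by measurable
    then show ?thesis
      unfolding \<pi>_def by (subst nn_integral_distr[OF m]) auto
  qed
  also have "\<dots> \<le> (\<integral>\<^sup>+ x. ennreal (n * \<bar>mean_square n x - 1\<bar>) \<partial>?P)"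
    using n by (intro nn_integral_mono ennreal_leI dist_normalize_to_sphere_le)
  \<comment> \<open>Integrability is essential here: the Bochner integral of a non-integrable
    function is 0 by default and would not equal the cost bound.\<close>
  also have "\<dots> = ennreal (\<integral>x. n * \<bar>mean_square n x - 1\<bar> \<partial>?P)"
  proof (rule nn_integral_eq_integral)
    have "integrable ?P (\<lambda>x. (x i)\<^sup>2)" if "i < n" for i
      using that f integrable_PiM_component[of "{..<n}" "\<lambda>_. f" i "\<lambda>x. x\<^sup>2"] by simp
    then show "integrable ?P (\<lambda>x. n * \<bar>mean_square n x - 1\<bar>)"
      by (intro integrable_mult_right integrable_abs Bochner_Integration.integrable_diff
          integrable_divide Bochner_Integration.integrable_sum) auto
  qed auto
  finally show ?thesis by simp
qed

text \<open>Bounds can thus be proved for the cost itself; the infinite value is its own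
  square.\<close>

lemma W2_power2: "(W2 n F G)\<^sup>2 = transport_cost2 n F G"
  by (cases "transport_cost2 n F G")
    (auto simp: W2_def power2_eq_square ennreal_top_mult simp flip: ennreal_mult)

section \<open>Rates of convergence from higher moments\<close>

text \<open>With R = n^(1/q) as level for |x|, that is T = R^2 for x^2, the tail is at most R^(2-q)
  M and the truncated fourth moment at most R^(4-q) M. After division by n and the square root, the
  latter has the same power of n as the former.\<close>

lemma mean_square_deviation_moment:
  assumes f: "prob_space f" "sets f = sets borel" and f2: "integrable f (\<lambda>x. x\<^sup>2)" "(\<integral>x. x\<^sup>2 \<partial>f) = 1"
    and q: "2 < q" "q \<le> 4" "integrable f (\<lambda>x. \<bar>x\<bar> powr q)" and n: "n \<ge> 1"
  defines "M \<equiv> \<integral>x. \<bar>x\<bar> powr q \<partial>f"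
  shows "(\<integral>x. \<bar>mean_square n x - 1\<bar> \<partial>tensor_power n f) \<le> (2 * M + sqrt M) * n powr (2 / q - 1)"
proof -
  note [measurable_cong] = f(2)
  define R where "R = real n powr (1 / q)"
  have R0: "R > 0" using n by (simp add: R_def)
  have le_iff: "x\<^sup>2 \<le> R\<^sup>2 \<longleftrightarrow> \<bar>x\<bar> \<le> R" for x
    using R0 abs_le_square_iff[of x R] by simp
  have sq: "y\<^sup>2 = y powr 2" if "y \<ge> 0" for y :: real
    using that by simp
  have four: "(y\<^sup>2)\<^sup>2 = y powr 4" if "y \<ge> 0" for y :: real
    using that by simp
  have M0: "M \<ge> 0" by (simp add: M_def)
  have "tail_mean f (\<lambda>x. x\<^sup>2) (R\<^sup>2) \<le> (\<integral>x. R powr (2 - q) * \<bar>x\<bar> powr q \<partial>f)"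
    unfolding tail_mean_def
  proof (rule integral_mono)
    show "integrable f (\<lambda>x. if x\<^sup>2 \<le> R\<^sup>2 then 0 else x\<^sup>2)"
      by (rule Bochner_Integration.integrable_bound[OF f2(1)]) auto
    fix x :: real
    show "(if x\<^sup>2 \<le> R\<^sup>2 then 0 else x\<^sup>2) \<le> R powr (2 - q) * \<bar>x\<bar> powr q"
    proof (cases "\<bar>x\<bar> \<le> R")
      case False
      have "x\<^sup>2 = \<bar>x\<bar> powr (2 - q) * \<bar>x\<bar> powr q"
        using sq[of "\<bar>x\<bar>"] False R0 by (simp flip: powr_add)
      \<comment> \<open>The exponent 2 - q is negative, so the power decreases beyond R.\<close>
      also have "\<dots> \<le> R powr (2 - q) * \<bar>x\<bar> powr q"
        using False R0 q by (intro mult_right_mono powr_mono2') auto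
      finally show ?thesis by (simp add: le_iff False)
    qed (simp add: le_iff)
  qed (use q in auto)
  also have "\<dots> = R powr (2 - q) * M" by (simp add: M_def)
  also have "R powr (2 - q) = n powr (2 / q - 1)"
    using q by (simp add: R_def powr_powr diff_divide_distrib)
  finally have tail: "tail_mean f (\<lambda>x. x\<^sup>2) (R\<^sup>2) \<le> n powr (2 / q - 1) * M" .
  have "(\<integral>x. (if x\<^sup>2 \<le> R\<^sup>2 then (x\<^sup>2)\<^sup>2 else 0) \<partial>f) \<le> (\<integral>x. R powr (4 - q) * \<bar>x\<bar> powr q \<partial>f)"
  proof (rule integral_mono)
    interpret prob_space f by fact
    show "integrable f (\<lambda>x. if x\<^sup>2 \<le> R\<^sup>2 then (x\<^sup>2)\<^sup>2 else 0)"
    proof (rule integrable_const_bound[where B="(R\<^sup>2)\<^sup>2"], rule AE_I2)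
      show "norm (if x\<^sup>2 \<le> R\<^sup>2 then (x\<^sup>2)\<^sup>2 else 0) \<le> (R\<^sup>2)\<^sup>2" for x
        using power_mono[of "x\<^sup>2" "R\<^sup>2" 2] by auto
    qed simp
    fix x :: real
    show "(if x\<^sup>2 \<le> R\<^sup>2 then (x\<^sup>2)\<^sup>2 else 0) \<le> R powr (4 - q) * \<bar>x\<bar> powr q"
    proof (cases "\<bar>x\<bar> \<le> R")
      case True
      have "(x\<^sup>2)\<^sup>2 = \<bar>x\<bar> powr (4 - q) * \<bar>x\<bar> powr q"
        using four[of "\<bar>x\<bar>"] by (simp flip: powr_add)
      \<comment> \<open>Here q <= 4 enters: the exponent is nonnegative and the power increases up
        to R.\<close>
      also have "\<dots> \<le> R powr (4 - q) * \<bar>x\<bar> powr q"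
        using True q by (intro mult_right_mono powr_mono2) auto
      finally show ?thesis by (simp add: le_iff True)
    qed (simp add: le_iff)
  qed (use q in auto)
  also have "\<dots> = R powr (4 - q) * M" by (simp add: M_def)
  finally have "sqrt ((\<integral>x. (if x\<^sup>2 \<le> R\<^sup>2 then (x\<^sup>2)\<^sup>2 else 0) \<partial>f) / n)
      \<le> sqrt (R powr (4 - q) / n * M)"
    by (intro real_sqrt_le_mono) (simp add: divide_right_mono)
  \<comment> \<open>The exponents match because (4/q - 1) - 1 = 2 (2/q - 1).\<close>
  also have "R powr (4 - q) / n = (n powr (2 / q - 1))\<^sup>2"
  proof -
    have "R powr (4 - q) / n = n powr (4 / q - 1) / n powr 1"
      using q by (simp add: R_def powr_powr diff_divide_distrib)
    also have "\<dots> = n powr ((2 / q - 1) + (2 / q - 1))"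
      using n by (subst powr_diff[symmetric]) simp
    also have "\<dots> = (n powr (2 / q - 1))\<^sup>2"
      unfolding powr_add power2_eq_square ..
    finally show ?thesis .
  qed
  also have "sqrt (\<dots> * M) = n powr (2 / q - 1) * sqrt M"
    by (simp add: real_sqrt_mult)
  finally have trunc: "sqrt ((\<integral>x. (if x\<^sup>2 \<le> R\<^sup>2 then (x\<^sup>2)\<^sup>2 else 0) \<partial>f) / n)
      \<le> n powr (2 / q - 1) * sqrt M" .
  show ?thesis
    using empirical_mean_deviation[OF f(1) f2(1) _ n, of "R\<^sup>2"] tail trunc
    by (simp add: f2 algebra_simps)
qed

lemma W2_f_hat_le:
  assumes f: "real_distribution f" and f2: "integrable f (\<lambda>x. x\<^sup>2)" "(\<integral>x. x\<^sup>2 \<partial>f) = 1"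
    and p: "p > 2" "integrable f (\<lambda>x. \<bar>x\<bar> powr p)" and n: "n \<ge> 1"
  shows "ennreal (1 / real n) * (W2 n (f_hat f n) (tensor_power n f))\<^sup>2
    \<le> ennreal (3 * ((\<integral>x. \<bar>x\<bar> powr p \<partial>f) + 1) * real n powr (2 / min p 4 - 1))"
proof -
  interpret f: real_distribution f by fact
  have fp: "prob_space f" by unfold_locales
  have fb: "sets f = sets borel" by simp
  \<comment> \<open>Moments beyond the fourth do not improve the exponent of this argument, so p is
    capped at 4.\<close>
  define q where "q = min p 4"
  have q: "2 < q" "q \<le> 4" "q \<le> p" using p by (auto simp: q_def)
  define M where "M = (\<integral>x. \<bar>x\<bar> powr q \<partial>f)"
  have le: "\<bar>x\<bar> powr q \<le> \<bar>x\<bar> powr p + 1" for x :: real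
  proof (cases "\<bar>x\<bar> \<ge> 1")
    case True
    then have "\<bar>x\<bar> powr q \<le> \<bar>x\<bar> powr p" using q by (intro powr_mono) auto
    then show ?thesis by simp
  next
    case False
    then have "\<bar>x\<bar> powr q \<le> 1" using q by (intro powr_le1) auto
    then show ?thesis by (simp add: add_increasing)
  qed
  have int: "integrable f (\<lambda>x. \<bar>x\<bar> powr p + 1)" using p by simp
  have qi: "integrable f (\<lambda>x. \<bar>x\<bar> powr q)"
    by (rule Bochner_Integration.integrable_bound[OF int])
      (auto intro!: AE_I2 order_trans[OF le] simp: abs_of_nonneg)
  have "M \<le> (\<integral>x. \<bar>x\<bar> powr p + 1 \<partial>f)"
    unfolding M_def using qi int le by (rule integral_mono)
  then have M: "M \<le> (\<integral>x. \<bar>x\<bar> powr p \<partial>f) + 1"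
    using p f.prob_space by simp
  have M0: "(\<integral>x. \<bar>x\<bar> powr p \<partial>f) \<ge> 0" by simp
  have "sqrt M \<le> sqrt ((\<integral>x. \<bar>x\<bar> powr p \<partial>f) + 1)" using M by simp
  \<comment> \<open>The added 1 makes the quantity at least 1, hence at least its square root. This
    is how 2 M + sqrt M turns into the factor 3.\<close>
  also have "\<dots> \<le> (\<integral>x. \<bar>x\<bar> powr p \<partial>f) + 1"
    using M0 by (intro real_le_lsqrt) (auto simp: power2_eq_square algebra_simps)
  finally have "2 * M + sqrt M \<le> 3 * ((\<integral>x. \<bar>x\<bar> powr p \<partial>f) + 1)" using M by simp
  then have const: "(2 * M + sqrt M) * n powr (2 / q - 1)
      \<le> 3 * ((\<integral>x. \<bar>x\<bar> powr p \<partial>f) + 1) * n powr (2 / q - 1)"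
    by (rule mult_right_mono) simp
  let ?E = "\<integral>x. \<bar>mean_square n x - 1\<bar> \<partial>tensor_power n f"
  have "ennreal (1 / real n) * (W2 n (f_hat f n) (tensor_power n f))\<^sup>2
      \<le> ennreal (1 / real n) * ennreal (real n * ?E)"
    unfolding W2_power2 using transport_cost2_f_hat_le[OF fp fb f2(1) n]
    by (rule mult_left_mono) simp
  also have "\<dots> = ennreal ?E"
    using n by (simp flip: ennreal_mult)
  also have "\<dots> \<le> ennreal ((2 * M + sqrt M) * n powr (2 / q - 1))"
    unfolding M_def using mean_square_deviation_moment[OF fp fb f2 q(1,2) qi n] by (rule ennreal_leI)
  also have "\<dots> \<le> ennreal (3 * ((\<integral>x. \<bar>x\<bar> powr p \<partial>f) + 1) * n powr (2 / q - 1))"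
    using const by (rule ennreal_leI)
  finally show ?thesis by (simp add: q_def)
qed

section \<open>Chaoticity and the three rates with a common constant\<close>

theorem theorem7:
  shows "(\<forall>f :: real measure.
            real_distribution f \<and> measure f {0} = 0 \<and>
            integrable f (\<lambda>x. x\<^sup>2) \<and> (\<integral>x. x\<^sup>2 \<partial>f) = 1
            \<longrightarrow> kac_chaotic (f_hat f) f) \<and>
         (\<exists>C :: real \<Rightarrow> real \<Rightarrow> real. \<forall>p > 2. \<forall>f :: real measure.
            real_distribution f \<and> measure f {0} = 0 \<and>
            integrable f (\<lambda>x. x\<^sup>2) \<and> (\<integral>x. x\<^sup>2 \<partial>f) = 1 \<and>
            integrable f (\<lambda>x. \<bar>x\<bar> powr p)
            \<longrightarrow> (\<forall>N \<ge> 2.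
                  ennreal (1 / real N) * (W2 N (f_hat f N) (tensor_power N f))\<^sup>2
                  \<le> ennreal (C p (\<integral>x. \<bar>x\<bar> powr p \<partial>f) *
                       (if p > 4 then real N powr (- 1 / 2)
                        else if p = 4 then real N powr (- 1 / 2) * ln (real N)
                        else real N powr (- (1 - 2 / p))))))"
proof (intro conjI allI impI exI[of _ "\<lambda>_ M. 3 * (M + 1) / ln 2"])
  fix f :: "real measure"
  assume "real_distribution f \<and> measure f {0} = 0 \<and> integrable f (\<lambda>x. x\<^sup>2) \<and> (\<integral>x. x\<^sup>2 \<partial>f) = 1"
  then show "kac_chaotic (f_hat f) f" by (intro kac_chaotic_f_hat) auto
next
  fix p :: real and f :: "real measure" and N :: nat
  assume p: "p > 2" and N: "N \<ge> 2"
    and "real_distribution f \<and> measure f {0} = 0 \<and>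
      integrable f (\<lambda>x. x\<^sup>2) \<and> (\<integral>x. x\<^sup>2 \<partial>f) = 1 \<and> integrable f (\<lambda>x. \<bar>x\<bar> powr p)"
  then have f: "real_distribution f" "integrable f (\<lambda>x. x\<^sup>2)" "(\<integral>x. x\<^sup>2 \<partial>f) = 1"
    "integrable f (\<lambda>x. \<bar>x\<bar> powr p)" by auto
  define K where "K = 3 * ((\<integral>x. \<bar>x\<bar> powr p \<partial>f) + 1)"
  have K: "K \<ge> 0" by (simp add: K_def)
  define rate where "rate = (if p > 4 then real N powr (- 1 / 2)
    else if p = 4 then real N powr (- 1 / 2) * ln (real N) else real N powr (- (1 - 2 / p)))"
  have ln2: "ln (2::real) > 0" "ln (2::real) \<le> 1" using ln_le_minus_one[of "2::real"] by auto
  \<comment> \<open>The division by ln 2 in the constant lets one formula serve all cases: for p = 4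
    it uses ln 2 <= ln N, that is N >= 2, and otherwise only ln 2 <= 1.\<close>
  have "real N powr (2 / min p 4 - 1) * ln 2 \<le> rate"
  proof (cases "p = 4")
    case True
    then show ?thesis using N by (simp add: rate_def)
  next
    case False
    then have "rate = real N powr (2 / min p 4 - 1)" by (auto simp: rate_def min_def)
    then show ?thesis using ln2 by (simp add: mult_left_le)
  qed
  then have "real N powr (2 / min p 4 - 1) \<le> rate / ln 2" using ln2 by (simp add: field_simps)
  then have "K * real N powr (2 / min p 4 - 1) \<le> K * (rate / ln 2)"
    using K by (rule mult_left_mono)
  then have "K * real N powr (2 / min p 4 - 1) \<le> K / ln 2 * rate" by simp
  moreover have "ennreal (1 / real N) * (W2 N (f_hat f N) (tensor_power N f))\<^sup>2
      \<le> ennreal (K * real N powr (2 / min p 4 - 1))"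
    unfolding K_def using N by (intro W2_f_hat_le f p) simp
  ultimately show "ennreal (1 / real N) * (W2 N (f_hat f N) (tensor_power N f))\<^sup>2
      \<le> ennreal (3 * ((\<integral>x. \<bar>x\<bar> powr p \<partial>f) + 1) / ln 2 *
          (if p > 4 then real N powr (- 1 / 2)
           else if p = 4 then real N powr (- 1 / 2) * ln (real N)
           else real N powr (- (1 - 2 / p))))"
    unfolding K_def rate_def by (blast intro: order_trans ennreal_leI)
qed

end
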